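(* Let $D,E,G,H$ be any complex numbers and put $A=-D+E+G+H-3$, $B=-4D+4E+4G+4H-12$, $C=-E-2G-H+4$, $F=-2D-2G-2H+6$, $J=4D-E+2G-H$. Then for all integers $m\ge0$ and $n\ge1$, $$\begin{aligned} &\frac1{(A_1^{(n)})^4}\sum_{k_1+k_2+k_3+k_4=m}\binom{m}{k_1,k_2,k_3,k_4}U_{k_1}^{(n)}U_{k_2}^{(n)}U_{k_3}^{(n)}U_{k_4}^{(n)}\\ &=\frac{A}{A_1^{(4n)}}4^mU_m^{(4n)}+B\left(\frac{-1}{563}\right)^n+\frac{C}{A_1^{(3n)}A_1^{(n)}}\sum_{k=0}^m\binom mk3^{m-k}U_{m-k}^{(3n)}U_k^{(n)}\\ &\quad+\frac{D}{(A_1^{(2n)})^2}\sum_{k=0}^m\binom mk2^mU_k^{(2n)}U_{m-k}^{(2n)}+\frac{E}{A_1^{(2n)}}\sum_{k=0}^m\binom mk2^{m-k}U_{m-k}^{(2n)}t_{1,k}^{(n)}\\ &\quad+F\sum_{k=0}^m\binom mkt_{1,k}^{(n)}t_{1,m-k}^{(n)}+\frac{G}{A_1^{(2n)}(A_1^{(n)})^2}\sum_{k_1+k_2+k_3=m}\binom{m}{k_1,k_2,k_3}2^{k_1}U_{k_1}^{(2n)}U_{k_2}^{(n)}U_{k_3}^{(n)}\\ &\quad+\frac{H}{(A_1^{(n)})^2}\sum_{k_1+k_2+k_3=m}\binom{m}{k_1,k_2,k_3}t_{1,k_1}^{(n)}U_{k_2}^{(n)}U_{k_3}^{(n)}\\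 &\quad+\frac{J}{A_2^{(n)}A_1^{(n)}}\sum_{k_1+k_2+k_3=m}\binom{m}{k_1,k_2,k_3}(-1)^{k_1}V_{k_1}^{(n)}U_{k_2}^{(n)}. \end{aligned}$$
   Context: Let $\alpha,\beta,\gamma,\delta$ be the (distinct, complex) roots of $x^4-x^3-x^2-x-1=0$ and $c_1=\frac1{-\alpha^3+6\alpha-1}$, $c_2=\frac1{-\beta^3+6\beta-1}$, $c_3=\frac1{-\gamma^3+6\gamma-1}$, $c_4=\frac1{-\delta^3+6\delta-1}$. A Tetranacci-type sequence is one in which, from index $4$ on, each term is the sum of the four preceding terms. For each $n\ge1$, let $A_1^{(n)}$ be the nonzero rational number and $U_k^{(n)}=T_{1,k}^{(s_{1,0}^{(n)},s_{1,1}^{(n)},s_{1,2}^{(n)},s_{1,3}^{(n)})}$ the Tetranacci-type sequence with integer initial values $U_j^{(n)}=s_{1,j}^{(n)}$ ($0\le j\le3$) of greatest common divisor $1$ such that $$c_1^ne^{\alpha x}+c_2^ne^{\beta x}+c_3^ne^{\gamma x}+c_4^ne^{\delta x}=\frac1{A_1^{(n)}}\sum_{k=0}^\infty U_k^{(n)}\frac{x^k}{k!}.$$ Likewise let $A_2^{(n)}$ be the nonzero rational number and $V_k^{(n)}=T_{2,k}^{(s_{2,0}^{(n)},s_{2,1}^{(n)},s_{2,2}^{(n)},s_{2,3}^{(n)})}$ the Tetranacci-type sequence with integer initial values $V_j^{(n)}=s_{2,j}^{(n)}$ ($0\le j\le3$) of greatest common divisor $1$ such that $$c_2^nc_3^nc_4^ne^{\alpha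 x}+c_1^nc_3^nc_4^ne^{\beta x}+c_1^nc_2^nc_4^ne^{\gamma x}+c_1^nc_2^nc_3^ne^{\delta x}=\frac1{A_2^{(n)}}\sum_{k=0}^\infty V_k^{(n)}\frac{x^k}{k!}.$$ The signs are fixed by requiring $U_k^{(n)}>0$ and $V_k^{(n)}>0$ for all sufficiently large $k$. Put $$t_{1,m}^{(n)}=\frac12\left(\frac1{(A_1^{(n)})^2}\sum_{k=0}^m\binom mkU_k^{(n)}U_{m-k}^{(n)}-\frac{2^m}{A_1^{(2n)}}U_m^{(2n)}\right),$$ equivalently $\sum_{m\ge0}t_{1,m}^{(n)}\frac{x^m}{m!}=c_1^nc_2^ne^{(\alpha+\beta)x}+c_1^nc_3^ne^{(\alpha+\gamma)x}+c_1^nc_4^ne^{(\alpha+\delta)x}+c_2^nc_3^ne^{(\beta+\gamma)x}+c_2^nc_4^ne^{(\beta+\delta)x}+c_3^nc_4^ne^{(\gamma+\delta)x}$. Superscripts $(n)$ are indices; $c_i^n$ is an $n$-th power. All indices $k_i$ run over nonnegative integers and $\binom{m}{k_1,\dots,k_r}=\frac{m!}{k_1!\cdots k_r!}$. *)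

theory Defs
  imports "HOL-Analysis.Analysis"
begin

definition tetranacci_roots :: "complex \<Rightarrow> complex \<Rightarrow> complex \<Rightarrow> complex \<Rightarrow> bool" where
  "tetranacci_roots \<alpha> \<beta> \<gamma> \<delta> \<longleftrightarrow>
     distinct [\<alpha>, \<beta>, \<gamma>, \<delta>] \<and> {z. z ^ 4 - z ^ 3 - z ^ 2 - z - 1 = 0} = {\<alpha>, \<beta>, \<gamma>, \<delta>}"

definition tetranacci_coeff :: "complex \<Rightarrow> complex" where
  "tetranacci_coeff z = 1 / (- (z ^ 3) + 6 * z - 1)"

definition tetranacci_type :: "(nat \<Rightarrow> int) \<Rightarrow> bool" where
  "tetranacci_type s \<longleftrightarrow> (\<forall>k\<ge>4. s k = s (k - 1) + s (k - 2) + s (k - 3) + s (k - 4))"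

text \<open>
  \<open>normalized_egf f A s\<close>: the function \<open>f\<close> equals \<open>1/A\<close> times the exponential generating
  function of the Tetranacci-type integer sequence \<open>s\<close>, normalized by coprimality of the initial
  values and by eventual positivity. The two normalizations determine the pair \<open>(A, s)\<close> from \<open>f\<close>.
\<close>

definition normalized_egf :: "(complex \<Rightarrow> complex) \<Rightarrow> rat \<Rightarrow> (nat \<Rightarrow> int) \<Rightarrow> bool" where
  "normalized_egf f A s \<longleftrightarrow>
     A \<noteq> 0 \<and> tetranacci_type s \<and> Gcd {s 0, s 1, s 2, s 3} = 1 \<and>
     (\<forall>x. (\<lambda>k. 1 / of_rat A * (of_int (s k) * (x ^ k / fact k))) sums f x) \<and>
     (\<forall>\<^sub>F k in sequentially. s k > 0)"

definition normalized_pair :: "(complex \<Rightarrow> complex) \<Rightarrow> rat \<times> (nat \<Rightarrow> int)" where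
  "normalized_pair f = (THE p. normalized_egf f (fst p) (snd p))"

definition egf1 :: "complex \<Rightarrow> complex \<Rightarrow> complex \<Rightarrow> complex \<Rightarrow> nat \<Rightarrow> complex \<Rightarrow> complex" where
  "egf1 \<alpha> \<beta> \<gamma> \<delta> n x =
     (let c1 = tetranacci_coeff \<alpha>; c2 = tetranacci_coeff \<beta>;
          c3 = tetranacci_coeff \<gamma>; c4 = tetranacci_coeff \<delta>
      in c1 ^ n * exp (\<alpha> * x) + c2 ^ n * exp (\<beta> * x)
       + c3 ^ n * exp (\<gamma> * x) + c4 ^ n * exp (\<delta> * x))"

definition egf2 :: "complex \<Rightarrow> complex \<Rightarrow> complex \<Rightarrow> complex \<Rightarrow> nat \<Rightarrow> complex \<Rightarrow> complex" where
  "egf2 \<alpha> \<beta> \<gamma> \<delta> n x =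
     (let c1 = tetranacci_coeff \<alpha>; c2 = tetranacci_coeff \<beta>;
          c3 = tetranacci_coeff \<gamma>; c4 = tetranacci_coeff \<delta>
      in c2 ^ n * c3 ^ n * c4 ^ n * exp (\<alpha> * x) + c1 ^ n * c3 ^ n * c4 ^ n * exp (\<beta> * x)
       + c1 ^ n * c2 ^ n * c4 ^ n * exp (\<gamma> * x) + c1 ^ n * c2 ^ n * c3 ^ n * exp (\<delta> * x))"

text \<open>
  The rational normalizers and integer sequences, embedded into the complex numbers; the superscript
  \<open>(n)\<close> is the argument \<open>n\<close>.
\<close>

definition tetra_A1 :: "complex \<Rightarrow> complex \<Rightarrow> complex \<Rightarrow> complex \<Rightarrow> nat \<Rightarrow> complex" where
  "tetra_A1 \<alpha> \<beta> \<gamma> \<delta> n = of_rat (fst (normalized_pair (egf1 \<alpha> \<beta> \<gamma> \<delta> n)))"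

definition tetra_U :: "complex \<Rightarrow> complex \<Rightarrow> complex \<Rightarrow> complex \<Rightarrow> nat \<Rightarrow> nat \<Rightarrow> complex" where
  "tetra_U \<alpha> \<beta> \<gamma> \<delta> n k = of_int (snd (normalized_pair (egf1 \<alpha> \<beta> \<gamma> \<delta> n)) k)"

definition tetra_A2 :: "complex \<Rightarrow> complex \<Rightarrow> complex \<Rightarrow> complex \<Rightarrow> nat \<Rightarrow> complex" where
  "tetra_A2 \<alpha> \<beta> \<gamma> \<delta> n = of_rat (fst (normalized_pair (egf2 \<alpha> \<beta> \<gamma> \<delta> n)))"

definition tetra_V :: "complex \<Rightarrow> complex \<Rightarrow> complex \<Rightarrow> complex \<Rightarrow> nat \<Rightarrow> nat \<Rightarrow> complex" where
  "tetra_V \<alpha> \<beta> \<gamma> \<delta> n k = of_int (snd (normalized_pair (egf2 \<alpha> \<beta> \<gamma> \<delta> n)) k)"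

definition tetra_t1 :: "complex \<Rightarrow> complex \<Rightarrow> complex \<Rightarrow> complex \<Rightarrow> nat \<Rightarrow> nat \<Rightarrow> complex" where
  "tetra_t1 \<alpha> \<beta> \<gamma> \<delta> n m =
     (let A1 = tetra_A1 \<alpha> \<beta> \<gamma> \<delta>; U = tetra_U \<alpha> \<beta> \<gamma> \<delta>
      in 1 / 2 * (1 / (A1 n) ^ 2 * (\<Sum>k=0..m. of_nat (m choose k) * U n k * U n (m - k))
                  - 2 ^ m / A1 (2 * n) * U (2 * n) m))"

text \<open>Intended for \<open>sum_list ks = m\<close>, where this is the usual multinomial coefficient.\<close>

definition multinomial :: "nat \<Rightarrow> nat list \<Rightarrow> complex" where
  "multinomial m ks = fact m / (\<Prod>k\<leftarrow>ks. fact k)"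

end

theory Submission
  imports Defs
begin

text \<open>
Let \<open>x\<^sub>i = c\<^sub>i ^ n * exp (\<alpha>\<^sub>i t)\<close>, where \<open>\<alpha>\<^sub>i\<close> runs over the four roots. Then \<open>U\<close> with
upper index \<open>j n\<close>, divided by its normalizer and scaled by \<open>j ^ k\<close>, has the power sum
\<open>\<Sum> x\<^sub>i ^ j\<close> as exponential generating function; \<open>t1\<close> belongs to the second elementary
symmetric function of the \<open>x\<^sub>i\<close>. Because the roots have sum \<open>1\<close>, the third one is \<open>exp t\<close> times
the generating function of \<open>(-1) ^ k * V\<close> divided by its normalizer; because the \<open>c\<^sub>i\<close> have product
\<open>- 1 / 563\<close>, the fourth one is \<open>(- 1 / 563) ^ n * exp t\<close>. The theorem is the comparison of
coefficients in a polynomial identity between these symmetric functions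
(\<open>quartic_symmetric_identity\<close>).

The normalizers and sequences are given by a definite description, so what remains is that the
description denotes (\<open>normalized_pair_moment\<close>). Four facts give this. The numbers
\<open>\<Sum> c\<^sub>i ^ n * \<alpha>\<^sub>i ^ k\<close> are rational, since \<open>c\<^sub>i\<close> is a rational polynomial in \<open>\<alpha>\<^sub>i\<close> and the power
sums of the roots are rational (\<open>rational_moments_coeff_power\<close>; similarly for the products of three
coefficients). They have a fixed sign for large \<open>k\<close>, since one real root exceeds the others in norm
(\<open>tetranacci_dominant_root\<close>, \<open>eventual_sign_of_moments\<close>). Clearing denominators then gives a
normalized sequence (\<open>normalized_egf_exists\<close>), and a normalized sequence is determined by the
function (\<open>normalized_egf_unique\<close>).
\<close>

section \<open>Symmetric functions of the roots\<close>

definition coeff_denom :: "complex \<Rightarrow> complex" where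
  "coeff_denom z = - (z ^ 3) + 6 * z - 1"

lemma tetranacci_coeff_eq_inverse: "tetranacci_coeff z = inverse (coeff_denom z)"
  by (simp add: tetranacci_coeff_def coeff_denom_def divide_inverse)

lemma tetranacci_roots_power4:
  assumes "tetranacci_roots \<alpha> \<beta> \<gamma> \<delta>" "z \<in> {\<alpha>, \<beta>, \<gamma>, \<delta>}"
  shows "z ^ 4 = z ^ 3 + z ^ 2 + z + 1"
proof -
  have "z \<in> {z. z ^ 4 - z ^ 3 - z ^ 2 - z - 1 = 0}"
    using assms unfolding tetranacci_roots_def by blast
  thus ?thesis by (simp add: algebra_simps)
qed

lemma tetranacci_roots_sum:
  assumes "tetranacci_roots \<alpha> \<beta> \<gamma> \<delta>"
  shows "(\<Sum>z\<in>{\<alpha>, \<beta>, \<gamma>, \<delta>}. h z) = h \<alpha> + h \<beta> + h \<gamma> + (h \<delta> :: complex)"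
  using assms by (simp add: tetranacci_roots_def add.assoc)

text \<open>
The set description of the roots gives no factorization of the quartic. Dividing the equations
\<open>f \<alpha> = f \<beta> = f \<gamma> = f \<delta> = 0\<close> successively by differences of distinct roots yields complete
homogeneous symmetric polynomials in two, three and four of the roots. The last of these is linear
and gives the sum of the roots; the others then give the remaining elementary symmetric functions.
\<close>

lemma tetranacci_vieta:
  assumes "tetranacci_roots \<alpha> \<beta> \<gamma> \<delta>"
  shows "\<alpha> + \<beta> + \<gamma> + \<delta> = 1"
    and "\<alpha>*\<beta> + \<alpha>*\<gamma> + \<alpha>*\<delta> + \<beta>*\<gamma> + \<beta>*\<delta> + \<gamma>*\<delta> = -1"
    and "\<alpha>*\<beta>*\<gamma> + \<alpha>*\<beta>*\<delta> + \<alpha>*\<gamma>*\<delta> + \<beta>*\<gamma>*\<delta> = 1"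
proof -
  have neq: "\<alpha> \<noteq> \<beta>" "\<alpha> \<noteq> \<gamma>" "\<alpha> \<noteq> \<delta>" "\<beta> \<noteq> \<gamma>" "\<beta> \<noteq> \<delta>" "\<gamma> \<noteq> \<delta>"
    using assms by (auto simp: tetranacci_roots_def)
  have rt: "\<alpha> ^ 4 = \<alpha> ^ 3 + \<alpha> ^ 2 + \<alpha> + 1" "\<beta> ^ 4 = \<beta> ^ 3 + \<beta> ^ 2 + \<beta> + 1"
    "\<gamma> ^ 4 = \<gamma> ^ 3 + \<gamma> ^ 2 + \<gamma> + 1" "\<delta> ^ 4 = \<delta> ^ 3 + \<delta> ^ 2 + \<delta> + 1"
    using tetranacci_roots_power4[OF assms] by auto
  have dd1: "x^3 + x^2*y + x*y^2 + y^3 - (x^2 + x*y + y^2) - (x + y) - 1 = 0"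
    if "x \<noteq> y" "x^4 = x^3 + x^2 + x + 1" "y^4 = y^3 + y^2 + y + 1" for x y :: complex
  proof -
    have "(x - y) * (x^3 + x^2*y + x*y^2 + y^3 - (x^2 + x*y + y^2) - (x + y) - 1) = 0"
      using that(2,3) by algebra
    thus ?thesis using that(1) by simp
  qed
  have dd2: "x^2 + y^2 + z^2 + x*y + x*z + y*z - (x + y + z) - 1 = 0"
    if "x \<noteq> y" "x \<noteq> z" "y \<noteq> z" "x^4 = x^3 + x^2 + x + 1" "y^4 = y^3 + y^2 + y + 1"
      "z^4 = z^3 + z^2 + z + 1" for x y z :: complex
  proof -
    have "(y - z) * (x^2 + y^2 + z^2 + x*y + x*z + y*z - (x + y + z) - 1) = 0"
      using dd1[OF that(1,4,5)] dd1[OF that(2,4,6)] by algebra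
    thus ?thesis using that(3) by simp
  qed
  note q1 = dd2[OF neq(1,2,4) rt(1,2,3)] and q2 = dd2[OF neq(1,3,5) rt(1,2,4)]
  have "(\<gamma> - \<delta>) * (\<alpha> + \<beta> + \<gamma> + \<delta> - 1) = 0"
    using q1 q2 by algebra
  thus e1: "\<alpha> + \<beta> + \<gamma> + \<delta> = 1" using neq(6) by simp
  hence d: "\<delta> = 1 - \<alpha> - \<beta> - \<gamma>" by (simp add: algebra_simps)
  show e2: "\<alpha>*\<beta> + \<alpha>*\<gamma> + \<alpha>*\<delta> + \<beta>*\<gamma> + \<beta>*\<delta> + \<gamma>*\<delta> = -1"
    using q1 unfolding d by algebra
  show "\<alpha>*\<beta>*\<gamma> + \<alpha>*\<beta>*\<delta> + \<alpha>*\<gamma>*\<delta> + \<beta>*\<gamma>*\<delta> = 1"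
    using dd1[OF neq(1) rt(1,2)] q1 unfolding d by algebra
qed

lemma tetranacci_power_sums:
  assumes "tetranacci_roots \<alpha> \<beta> \<gamma> \<delta>"
  shows "\<alpha> + \<beta> + \<gamma> + \<delta> = 1"
    and "\<alpha>^2 + \<beta>^2 + \<gamma>^2 + \<delta>^2 = 3"
    and "\<alpha>^3 + \<beta>^3 + \<gamma>^3 + \<delta>^3 = 7"
  using tetranacci_vieta[OF assms] by algebra+

text \<open>
Newton's identity for the fourth elementary symmetric polynomial in four variables.
\<close>

lemma prod4_from_power_sums:
  fixes a b c d :: complex
  assumes "p1 = a + b + c + d" "p2 = a^2 + b^2 + c^2 + d^2"
    "p3 = a^3 + b^3 + c^3 + d^3" "p4 = a^4 + b^4 + c^4 + d^4"
  shows "24 * (a * b * c * d) = p1^4 - 6 * p1^2 * p2 + 3 * p2^2 + 8 * p1 * p3 - 6 * p4"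
  unfolding assms by algebra

text \<open>
The powers of \<open>coeff_denom z\<close> up to the fourth are reduced modulo the quartic to cubics in \<open>z\<close>, so
their sums over the roots follow from the power sums of the roots. Newton's identity turns these
four sums into the product. The value is the discriminant of the quartic.
\<close>

lemma prod_coeff_denom:
  assumes "tetranacci_roots \<alpha> \<beta> \<gamma> \<delta>"
  shows "coeff_denom \<alpha> * coeff_denom \<beta> * coeff_denom \<gamma> * coeff_denom \<delta> = -563"
proof -
  let ?R = "{\<alpha>, \<beta>, \<gamma>, \<delta>}"
  note ps = tetranacci_power_sums[OF assms]
  note root = tetranacci_roots_power4[OF assms]
  have sum_cubic: "(\<Sum>z\<in>?R. a + b * z + c * z^2 + d * z^3) = 4 * a + b + 3 * c + 7 * d"
    for a b c d :: complex
  proof -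
    have "(\<Sum>z\<in>?R. a + b * z + c * z^2 + d * z^3)
        = 4 * a + b * (\<alpha> + \<beta> + \<gamma> + \<delta>) + c * (\<alpha>^2 + \<beta>^2 + \<gamma>^2 + \<delta>^2)
          + d * (\<alpha>^3 + \<beta>^3 + \<gamma>^3 + \<delta>^3)"
      unfolding tetranacci_roots_sum[OF assms] by (simp add: algebra_simps)
    thus ?thesis unfolding ps by simp
  qed
  have g1: "coeff_denom z ^ 1 = -1 + 6 * z + 0 * z^2 + (-1) * z^3" for z
    by (simp add: coeff_denom_def)
  have g2: "coeff_denom z ^ 2 = -9 + (-21) * z + 28 * z^2 + (-6) * z^3" if "z \<in> ?R" for z
    using root[OF that] unfolding coeff_denom_def by algebra
  have g3: "coeff_denom z ^ 3 = -22 + (-86) * z + (-201) * z^2 + 136 * z^3" if "z \<in> ?R" for z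
    using root[OF that] unfolding coeff_denom_def by algebra
  have g4: "coeff_denom z ^ 4 = 853 + 850 * z + 445 * z^2 + (-560) * z^3" if "z \<in> ?R" for z
    using root[OF that] unfolding coeff_denom_def by algebra
  have "(\<Sum>z\<in>?R. coeff_denom z ^ 1) = -5" "(\<Sum>z\<in>?R. coeff_denom z ^ 2) = -15"
    "(\<Sum>z\<in>?R. coeff_denom z ^ 3) = 175" "(\<Sum>z\<in>?R. coeff_denom z ^ 4) = 1677"
    using trans[OF sum.cong[OF refl g1] sum_cubic] trans[OF sum.cong[OF refl g2] sum_cubic]
      trans[OF sum.cong[OF refl g3] sum_cubic] trans[OF sum.cong[OF refl g4] sum_cubic]
    by simp_all
  hence "24 * (coeff_denom \<alpha> * coeff_denom \<beta> * coeff_denom \<gamma> * coeff_denom \<delta>) =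
      (-5)^4 - 6 * (-5)^2 * (-15) + 3 * (-15)^2 + 8 * (-5) * 175 - 6 * 1677"
    by (intro prod4_from_power_sums) (simp_all add: tetranacci_roots_sum[OF assms])
  also have "\<dots> = 24 * (-563)" by simp
  finally show ?thesis by (subst (asm) mult_cancel_left) simp
qed

lemma coeff_denom_nonzero:
  assumes "tetranacci_roots \<alpha> \<beta> \<gamma> \<delta>" "z \<in> {\<alpha>, \<beta>, \<gamma>, \<delta>}"
  shows "coeff_denom z \<noteq> 0"
  using prod_coeff_denom[OF assms(1)] assms(2) by auto

section \<open>Rational moments\<close>

text \<open>
The moments of a weight are, up to the factor \<open>1 / k!\<close>, the Taylor coefficients of
\<open>\<Sum>z\<in>R. w z * exp (z * x)\<close>.
\<close>
definition moment :: "complex set \<Rightarrow> (complex \<Rightarrow> complex) \<Rightarrow> nat \<Rightarrow> complex" where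
  "moment R w k = (\<Sum>z\<in>R. w z * z ^ k)"

lemma moment_recurrence:
  assumes "\<And>z. z \<in> R \<Longrightarrow> z ^ 4 = z ^ 3 + z ^ 2 + z + 1"
  shows "moment R w (k + 4) = moment R w (k + 3) + moment R w (k + 2) + moment R w (k + 1) + moment R w k"
  using assms
  by (auto simp: moment_def power_add power2_eq_square power3_eq_cube sum.distrib[symmetric]
      algebra_simps intro!: sum.cong)

text \<open>
The right-hand side is the inverse of \<open>- z^3 + 6 z - 1\<close> modulo the quartic. Having the coefficients
as rational polynomials in the root is what makes their power moments rational.
\<close>

lemma tetranacci_coeff_polynomial:
  assumes "tetranacci_roots \<alpha> \<beta> \<gamma> \<delta>" "z \<in> {\<alpha>, \<beta>, \<gamma>, \<delta>}"
  shows "tetranacci_coeff z = (86 * z^3 - 61 * z^2 - 71 * z - 87) / 563"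
proof -
  have "coeff_denom z * (86 * z^3 - 61 * z^2 - 71 * z - 87) = 563"
    using tetranacci_roots_power4[OF assms] unfolding coeff_denom_def by algebra
  thus ?thesis
    using coeff_denom_nonzero[OF assms]
    by (simp add: tetranacci_coeff_eq_inverse field_simps)
qed

definition rational_moments :: "complex set \<Rightarrow> (complex \<Rightarrow> complex) \<Rightarrow> bool" where
  "rational_moments R w \<longleftrightarrow> (\<forall>k. moment R w k \<in> \<rat>)"

text \<open>
Multiplying the weight by \<open>z\<close> shifts the moment sequence, so rationality of moments passes to
rational polynomial multiples of the weight. This replaces an appeal to Galois theory.
\<close>

lemma rational_moments_mult_cubic:
  assumes "rational_moments R w" "a \<in> \<rat>" "b \<in> \<rat>" "c \<in> \<rat>" "d \<in> \<rat>"
  shows "rational_moments R (\<lambda>z. (a * z^3 + b * z^2 + c * z + d) * w z)"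
proof -
  have "moment R (\<lambda>z. (a * z^3 + b * z^2 + c * z + d) * w z) k =
    a * moment R w (k + 3) + b * moment R w (k + 2) + c * moment R w (k + 1) + d * moment R w k" for k
    by (simp add: moment_def sum_distrib_left power_add power2_eq_square power3_eq_cube
        sum.distrib[symmetric] algebra_simps)
  thus ?thesis using assms by (simp add: rational_moments_def)
qed

lemma rational_moments_cong:
  "(\<And>z. z \<in> R \<Longrightarrow> w z = w' z) \<Longrightarrow> rational_moments R w = rational_moments R w'"
  by (simp add: rational_moments_def moment_def)

lemma rational_moments_one:
  assumes "tetranacci_roots \<alpha> \<beta> \<gamma> \<delta>"
  shows "rational_moments {\<alpha>, \<beta>, \<gamma>, \<delta>} (\<lambda>z. 1)"
proof -
  let ?R = "{\<alpha>, \<beta>, \<gamma>, \<delta>}"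
  have "moment ?R (\<lambda>z. 1) k \<in> \<rat>" for k
  proof (induction k rule: less_induct)
    case (less k)
    have m: "moment ?R (\<lambda>z. 1) k = \<alpha>^k + \<beta>^k + \<gamma>^k + \<delta>^k" for k
      unfolding moment_def tetranacci_roots_sum[OF assms] by simp
    have "k = 0 \<or> k = 1 \<or> k = 2 \<or> k = 3 \<or> k = (k - 4) + 4" by linarith
    then consider "k = 0" | "k = 1" | "k = 2" | "k = 3" | j where "k = j + 4" by blast
    thus ?case
    proof cases
      case 5
      have "moment ?R (\<lambda>z. 1) (j + i) \<in> \<rat>" if "i < 4" for i
        using less.IH[of "j + i"] that by (simp add: 5)
      from this[of 0] this[of 1] this[of 2] this[of 3] show ?thesis
        using moment_recurrence[OF tetranacci_roots_power4[OF assms], of ?R "\<lambda>z. 1" j]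
        by (simp add: 5)
    qed (simp_all add: m tetranacci_power_sums[OF assms, simplified])
  qed
  thus ?thesis by (simp add: rational_moments_def)
qed

lemma rational_moments_power_cubic:
  assumes "rational_moments R (\<lambda>z. 1)" "a \<in> \<rat>" "b \<in> \<rat>" "c \<in> \<rat>" "d \<in> \<rat>"
    and "\<And>z. z \<in> R \<Longrightarrow> w z = a * z^3 + b * z^2 + c * z + d"
  shows "rational_moments R (\<lambda>z. w z ^ n)"
proof -
  have "rational_moments R (\<lambda>z. (a * z^3 + b * z^2 + c * z + d) ^ n)"
    by (induction n) (simp_all add: assms(1) rational_moments_mult_cubic[OF _ assms(2-5)])
  thus ?thesis using assms(6) by (subst rational_moments_cong) auto
qed

lemma rational_moments_coeff_power:
  assumes "tetranacci_roots \<alpha> \<beta> \<gamma> \<delta>"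
  shows "rational_moments {\<alpha>, \<beta>, \<gamma>, \<delta>} (\<lambda>z. tetranacci_coeff z ^ n)"
  by (rule rational_moments_power_cubic[OF rational_moments_one[OF assms],
        of "86 / 563" "-61 / 563" "-71 / 563" "-87 / 563"])
     (use tetranacci_coeff_polynomial[OF assms] in \<open>simp_all add: diff_divide_distrib\<close>)

lemma rational_moments_denom_power:
  assumes "tetranacci_roots \<alpha> \<beta> \<gamma> \<delta>"
  shows "rational_moments {\<alpha>, \<beta>, \<gamma>, \<delta>} (\<lambda>z. (- coeff_denom z / 563) ^ n)"
  by (rule rational_moments_power_cubic[OF rational_moments_one[OF assms],
        of "1 / 563" 0 "-6 / 563" "1 / 563"])
     (simp_all add: coeff_denom_def field_simps)

section \<open>The dominant root and eventual signs\<close>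

text \<open>
The quartic \<open>t^4 - t^3 - t^2 - t - 1\<close> divided by \<open>t^4\<close> increases for \<open>t > 0\<close>, so the triangle
inequality excludes roots of norm larger than the positive zero \<open>\<rho>\<close>. Multiplying the equation by
\<open>z - 1\<close> gives \<open>z^4 * (2 - z) = 1\<close>. A root with \<open>norm z = \<rho>\<close> therefore satisfies
\<open>norm (2 - z) = 2 - \<rho>\<close>, which puts it on two circles that touch only at \<open>\<rho>\<close>.
\<close>

lemma tetranacci_dominant_root:
  obtains \<rho> :: real where "\<rho> > 1" "\<rho> ^ 4 = \<rho> ^ 3 + \<rho> ^ 2 + \<rho> + 1"
    "\<And>z :: complex. z ^ 4 = z ^ 3 + z ^ 2 + z + 1 \<Longrightarrow> z \<noteq> of_real \<rho> \<Longrightarrow> norm z < \<rho>"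
proof -
  have "\<exists>\<rho>\<ge>1. \<rho> \<le> 2 \<and> \<rho> ^ 4 - \<rho> ^ 3 - \<rho> ^ 2 - \<rho> - 1 = (0::real)"
    by (rule IVT') (auto intro!: continuous_intros)
  then obtain \<rho> :: real where \<rho>: "\<rho> \<ge> 1" "\<rho> ^ 4 - \<rho> ^ 3 - \<rho> ^ 2 - \<rho> - 1 = 0" by auto
  have gt1: "\<rho> > 1" using \<rho> by (cases "\<rho> = 1") auto
  have root: "\<rho> ^ 4 = \<rho> ^ 3 + \<rho> ^ 2 + \<rho> + 1" using \<rho>(2) by linarith
  have "norm z < \<rho>" if z: "z ^ 4 = z ^ 3 + z ^ 2 + z + 1" and ne: "z \<noteq> of_real \<rho>" for z :: complex
  proof -
    define r where "r = norm z"
    have r0: "r \<ge> 0" by (simp add: r_def)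
    have le: "r ^ 4 \<le> r ^ 3 + r ^ 2 + r + 1"
    proof -
      have "r ^ 4 = norm (z ^ 3 + z ^ 2 + z + 1)"
        by (simp add: r_def norm_power flip: z)
      also have "\<dots> \<le> norm (z ^ 3) + norm (z ^ 2) + norm z + norm (1::complex)"
        by (intro order.trans[OF norm_triangle_ineq] add_mono order.refl)
      finally show ?thesis by (simp add: r_def norm_power)
    qed
    have "r \<le> \<rho>"
    proof (rule ccontr)
      assume "\<not> r \<le> \<rho>"
      hence gt: "r > \<rho>" by simp
      \<comment> \<open>Each quotient r ^ j / r ^ 4 is at most its value at the smaller point \<rho>.\<close>
      have "\<rho> ^ 4 * r ^ j \<le> r ^ 4 * \<rho> ^ j" if "j \<le> 4" for j
      proof -
        have "(r * \<rho>) ^ j * \<rho> ^ (4 - j) \<le> (r * \<rho>) ^ j * r ^ (4 - j)"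
          using gt gt1 by (intro mult_left_mono power_mono) auto
        moreover have "x ^ 4 = x ^ j * x ^ (4 - j)" for x :: real
          using that by (simp flip: power_add)
        ultimately show ?thesis by (simp add: power_mult_distrib mult_ac)
      qed
      note mono = this[of 1] this[of 2] this[of 3]
      have "\<rho> ^ 4 < r ^ 4" using gt gt1 by (intro power_strict_mono) auto
      hence "\<rho> ^ 4 * (r ^ 3 + r ^ 2 + r + 1) < r ^ 4 * (\<rho> ^ 3 + \<rho> ^ 2 + \<rho> + 1)"
        using mono by (simp add: algebra_simps)
      also have "\<dots> = \<rho> ^ 4 * r ^ 4" by (simp flip: root)
      also have "\<dots> \<le> \<rho> ^ 4 * (r ^ 3 + r ^ 2 + r + 1)"
        using le gt1 by (intro mult_left_mono) auto
      finally show False by simp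
    qed
    moreover have "r \<noteq> \<rho>"
    proof
      assume eq: "r = \<rho>"
      \<comment> \<open>This is the quartic multiplied by z - 1.\<close>
      have "z ^ 4 * (2 - z) = 1" using z by algebra
      hence "norm z ^ 4 * norm (2 - z) = 1" by (metis norm_mult norm_one norm_power)
      hence "\<rho> ^ 4 * norm (2 - z) = 1" using eq by (simp add: r_def)
      moreover have "\<rho> ^ 4 * (2 - \<rho>) = 1" using root by algebra
      ultimately have "\<rho> ^ 4 * norm (2 - z) = \<rho> ^ 4 * (2 - \<rho>)" by simp
      hence "norm (2 - z) = 2 - \<rho>" using gt1 by simp
      hence "(2 - Re z)\<^sup>2 + (Im z)\<^sup>2 = (2 - \<rho>)\<^sup>2"
        using cmod_power2[of "2 - z"] by simp
      moreover have sq: "(Re z)\<^sup>2 + (Im z)\<^sup>2 = \<rho>\<^sup>2"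
        using cmod_power2[of z] eq by (simp add: r_def)
      ultimately have "Re z = \<rho>" by (simp add: power2_eq_square algebra_simps)
      with sq have "z = of_real \<rho>" by (simp add: complex_eq_iff)
      with ne show False by simp
    qed
    ultimately show ?thesis by (simp add: r_def)
  qed
  with gt1 root show ?thesis using that by blast
qed

lemma moment_asymptotics:
  assumes "finite R" "of_real \<rho> \<in> R" "\<rho> > 0"
    and "\<And>z. z \<in> R \<Longrightarrow> z \<noteq> of_real \<rho> \<Longrightarrow> norm z < \<rho>"
  shows "(\<lambda>k. moment R w k / of_real \<rho> ^ k) \<longlonglongrightarrow> w (of_real \<rho>)"
proof -
  have "(\<lambda>k. \<Sum>z\<in>R. w z * (z / of_real \<rho>) ^ k)
      \<longlonglongrightarrow> (\<Sum>z\<in>R. if z = of_real \<rho> then w z else 0)"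
  proof (rule tendsto_sum)
    fix z assume z: "z \<in> R"
    show "(\<lambda>k. w z * (z / of_real \<rho>) ^ k) \<longlonglongrightarrow> (if z = of_real \<rho> then w z else 0)"
    proof (cases "z = of_real \<rho>")
      case False
      have "norm (z / of_real \<rho>) < 1"
        using assms(4)[OF z False] assms(3) by (simp add: norm_divide)
      hence "(\<lambda>k. (z / of_real \<rho>) ^ k) \<longlonglongrightarrow> 0" by (rule LIMSEQ_power_zero)
      hence "(\<lambda>k. w z * (z / of_real \<rho>) ^ k) \<longlonglongrightarrow> w z * 0" by (rule tendsto_mult_left)
      thus ?thesis using False by simp
    qed (use assms(3) in simp)
  qed
  thus ?thesis
    using assms(1,2) by (simp add: moment_def sum_divide_distrib power_divide sum.delta)
qed

text \<open>
Divided by \<open>\<rho> ^ k\<close>, the moments are real and converge to the weight of the dominant root. That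
weight is then real and nonzero, and its sign is eventually the sign of the moments.
\<close>

lemma eventual_sign_of_moments:
  fixes r :: "nat \<Rightarrow> rat"
  assumes "finite R" "of_real \<rho> \<in> R" "\<rho> > 0"
    and "\<And>z. z \<in> R \<Longrightarrow> z \<noteq> of_real \<rho> \<Longrightarrow> norm z < \<rho>"
    and r: "\<And>k. moment R w k = of_rat (r k)" and "w (of_real \<rho>) \<noteq> 0"
  shows "(\<forall>\<^sub>F k in sequentially. r k > 0) \<or> (\<forall>\<^sub>F k in sequentially. r k < 0)"
proof -
  have eq: "moment R w k / of_real \<rho> ^ k = of_real (of_rat (r k) / \<rho> ^ k)" for k
  proof (cases "r k")
    case (Fract a b)
    thus ?thesis by (simp add: r of_rat_rat)
  qed
  have lim: "(\<lambda>k. of_real (of_rat (r k) / \<rho> ^ k)) \<longlonglongrightarrow> w (of_real \<rho>)"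
    using moment_asymptotics[OF assms(1-4), of w] unfolding eq .
  from tendsto_Im[OF lim] have "Im (w (of_real \<rho>)) = 0"
    by (simp add: LIMSEQ_const_iff)
  hence "Re (w (of_real \<rho>)) \<noteq> 0" using assms(6) by (simp add: complex_eq_iff)
  moreover have Re_lim: "(\<lambda>k. of_rat (r k) / \<rho> ^ k) \<longlonglongrightarrow> Re (w (of_real \<rho>))"
    using tendsto_Re[OF lim] by simp
  ultimately consider "Re (w (of_real \<rho>)) > 0" | "Re (w (of_real \<rho>)) < 0" by linarith
  thus ?thesis
  proof cases
    case 1
    from order_tendstoD(1)[OF Re_lim 1] show ?thesis
      using assms(3) by (simp add: zero_less_divide_iff)
  next
    case 2
    from order_tendstoD(2)[OF Re_lim 2] show ?thesis
      using assms(3) by (simp add: divide_less_0_iff)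
  qed
qed

section \<open>Normalized integer sequences\<close>

lemma common_denominator:
  fixes r :: "nat \<Rightarrow> rat"
  shows "\<exists>d>0. \<forall>j<N. of_int d * r j \<in> \<int>"
proof (induction N)
  case 0
  show ?case by (intro exI[of _ 1]) auto
next
  case (Suc N)
  then obtain d where d: "d > 0" "\<And>j. j < N \<Longrightarrow> of_int d * r j \<in> \<int>" by blast
  obtain a b :: int where ab: "r N = Fract a b" "b > 0" by (cases "r N") auto
  have "of_int (d * b) * r j \<in> \<int>" if "j < Suc N" for j
  proof (cases "j = N")
    case True
    have "of_int (d * b) * r j = of_int (d * a)"
      using ab by (simp add: True Fract_of_int_quotient)
    thus ?thesis by (metis Ints_of_int)
  next
    case False
    have "of_int (d * b) * r j = of_int b * (of_int d * r j)" by (simp add: mult_ac)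
    thus ?thesis using d(2)[of j] False that by (metis Ints_mult Ints_of_int less_SucE)
  qed
  thus ?case using d(1) ab(2) by (intro exI[of _ "d * b"]) auto
qed

lemma primitive_scaling:
  fixes r :: "nat \<Rightarrow> rat"
  assumes "\<exists>j<N. r j \<noteq> 0"
  obtains c :: rat and i :: "nat \<Rightarrow> int"
  where "c > 0" "\<And>j. j < N \<Longrightarrow> of_int (i j) = c * r j" "Gcd (i ` {..<N}) = 1"
proof -
  obtain d where d: "d > 0" "\<And>j. j < N \<Longrightarrow> of_int d * r j \<in> \<int>"
    using common_denominator[of N r] by blast
  define i where "i j = \<lfloor>of_int d * r j\<rfloor>" for j
  have i: "of_int (i j) = of_int d * r j" if "j < N" for j
    using d(2)[OF that] by (auto simp: i_def elim!: Ints_cases)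
  define g where "g = Gcd (i ` {..<N})"
  have "g \<noteq> 0"
  proof
    assume "g = 0"
    hence "i j = 0" if "j < N" for j using that by (auto simp: g_def Gcd_0_iff)
    with i d(1) assms show False by fastforce
  qed
  hence g: "g > 0" using g_def by (metis Gcd_int_greater_eq_0 le_less)
  have gd: "i j = g * (i j div g)" if "j < N" for j
    using that by (simp add: g_def Gcd_dvd)
  show ?thesis
  proof (rule that)
    show "of_int d / of_int g > (0::rat)" using d(1) g by simp
    show "of_int (i j div g) = of_int d / of_int g * r j" if "j < N" for j
    proof -
      have "of_int g * of_int (i j div g) = of_int d * r j"
        using i[OF that] gd[OF that] by (metis of_int_mult)
      thus ?thesis using g by (simp add: field_simps)
    qed
    have "g = Gcd ((*) g ` (\<lambda>j. i j div g) ` {..<N})"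
      unfolding image_image using gd by (subst g_def, intro arg_cong[of _ _ Gcd] image_cong) auto
    also have "\<dots> = normalize (g * Gcd ((\<lambda>j. i j div g) ` {..<N}))" by (rule Gcd_mult)
    finally show "Gcd ((\<lambda>j. i j div g) ` {..<N}) = 1"
      using g by (simp add: abs_mult)
  qed
qed

lemma power_series_coefficients_unique:
  fixes a b :: "nat \<Rightarrow> complex"
  assumes "\<And>x. (\<lambda>k. a k * x ^ k) sums f x" "\<And>x. (\<lambda>k. b k * x ^ k) sums f x"
  shows "a = b"
proof -
  have "fps_conv_radius (Abs_fps a) = \<infinity>" "fps_conv_radius (Abs_fps b) = \<infinity>"
    unfolding fps_conv_radius_def
    using assms by (auto intro!: conv_radius_inftyI'' simp: sums_iff)
  moreover have "eval_fps (Abs_fps a) = f" "eval_fps (Abs_fps b) = f"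
    using assms by (auto simp: eval_fps_def sums_iff)
  ultimately have "Abs_fps a = Abs_fps b" by (intro eval_fps_eqD) auto
  thus ?thesis by (metis fps_nth_Abs_fps ext)
qed

lemma normalized_egf_coefficients:
  assumes "normalized_egf f A s" "\<And>x. (\<lambda>k. M k * (x ^ k / fact k)) sums f x"
  shows "of_int (s k) / of_rat A = M k"
proof -
  have "(\<lambda>k. of_int (s k) / of_rat A / fact k) = (\<lambda>k. M k / fact k)"
    by (rule power_series_coefficients_unique[where f = f])
       (use assms in \<open>simp_all add: normalized_egf_def field_simps\<close>)
  thus ?thesis by (metis divide_cancel_right fact_nonzero)
qed

lemma tetranacci_type_iff:
  "tetranacci_type s \<longleftrightarrow> (\<forall>k. s (k + 4) = s (k + 3) + s (k + 2) + s (k + 1) + s k)"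
proof
  assume *: "tetranacci_type s"
  show "\<forall>k. s (k + 4) = s (k + 3) + s (k + 2) + s (k + 1) + s k"
  proof
    fix k show "s (k + 4) = s (k + 3) + s (k + 2) + s (k + 1) + s k"
      using *[unfolded tetranacci_type_def, rule_format, of "k + 4"]
      by (simp add: numeral_eq_Suc)
  qed
next
  assume *: "\<forall>k. s (k + 4) = s (k + 3) + s (k + 2) + s (k + 1) + s k"
  show "tetranacci_type s"
    unfolding tetranacci_type_def
  proof (intro allI impI)
    fix k :: nat assume "k \<ge> 4"
    then obtain j where j: "k = j + 4" by (metis le_add_diff_inverse2)
    show "s k = s (k - 1) + s (k - 2) + s (k - 3) + s (k - 4)"
      using *[rule_format, of j] by (simp add: j numeral_eq_Suc)
  qed
qed

lemma initial_values_image: "s ` {..<4} = {s 0, s 1, s 2, s (3::nat)}"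
  by (auto simp: lessThan_Suc numeral_eq_Suc)

text \<open>
Clearing denominators and dividing by the content makes the initial values coprime integers; the
recurrence keeps all later terms integral. The sign of \<open>A\<close> is then chosen to make the
sequence eventually positive.
\<close>

lemma normalized_egf_exists:
  fixes r :: "nat \<Rightarrow> rat"
  assumes sums: "\<And>x. (\<lambda>k. of_rat (r k) * (x ^ k / fact k)) sums f x"
    and rec: "\<And>k. r (k + 4) = r (k + 3) + r (k + 2) + r (k + 1) + r k"
    and sign: "(\<forall>\<^sub>F k in sequentially. r k > 0) \<or> (\<forall>\<^sub>F k in sequentially. r k < 0)"
  shows "\<exists>A s. normalized_egf f A s"
proof -
  have "\<exists>j<4. r j \<noteq> 0"
  proof (rule ccontr)
    assume zero: "\<not> (\<exists>j<4. r j \<noteq> 0)"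
    have "r k = 0" for k
    proof (induction k rule: less_induct)
      case (less k)
      show ?case
      proof (cases "k < 4")
        case False
        then obtain j where "k = j + 4" by (metis le_add_diff_inverse2 not_less)
        thus ?thesis using rec[of j] less by simp
      qed (use zero in auto)
    qed
    with sign show False by simp
  qed
  then obtain c i where c: "c > 0" and i: "\<And>j. j < 4 \<Longrightarrow> of_int (i j) = c * r j"
    and gcd: "Gcd (i ` {..<4}) = 1"
    using primitive_scaling[of 4 r] by metis
  have int: "c * r k \<in> \<int>" for k
  proof (induction k rule: less_induct)
    case (less k)
    show ?case
    proof (cases "k < 4")
      case True
      thus ?thesis by (metis i Ints_of_int)
    next
      case False
      then obtain j where j: "k = j + 4" by (metis le_add_diff_inverse2 not_less)
      have "c * r k = c * r (j + 3) + c * r (j + 2) + c * r (j + 1) + c * r j"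
        by (simp add: j rec algebra_simps)
      also have "\<dots> \<in> \<int>" by (intro Ints_add less) (simp_all add: j)
      finally show ?thesis .
    qed
  qed
  define e :: int where "e = (if \<forall>\<^sub>F k in sequentially. r k > 0 then 1 else -1)"
  have e: "e = 1 \<or> e = -1" "\<forall>\<^sub>F k in sequentially. of_int e * r k > 0"
    using sign by (auto simp: e_def)
  define A where "A = of_int e * c"
  define s where "s k = e * \<lfloor>c * r k\<rfloor>" for k
  have s: "of_int (s k) = A * r k" for k
    using int[of k] by (auto simp: s_def A_def elim!: Ints_cases)
  have A0: "A \<noteq> 0" using c e(1) by (auto simp: A_def)
  have "of_int (s (k + 4)) = (of_int (s (k + 3) + s (k + 2) + s (k + 1) + s k) :: rat)" for k
    by (simp add: s rec algebra_simps)
  hence tt: "tetranacci_type s" unfolding tetranacci_type_iff of_int_eq_iff by blast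
  have "s j = e * i j" if "j < 4" for j
    by (simp add: s_def flip: i[OF that])
  hence "s ` {..<4} = (*) e ` i ` {..<4}" by (simp add: image_image)
  hence "Gcd (s ` {..<4}) = normalize (e * Gcd (i ` {..<4}))" by (simp only: Gcd_mult)
  hence "Gcd {s 0, s 1, s 2, s 3} = 1"
    using e(1) gcd unfolding initial_values_image by auto
  moreover have "(\<lambda>k. 1 / of_rat A * (of_int (s k) * (x ^ k / fact k))) sums f x" for x
  proof -
    have "of_int (s k) = (of_rat A * of_rat (r k) :: complex)" for k
      by (metis s of_rat_mult of_rat_of_int_eq)
    thus ?thesis using sums[of x] A0 by simp
  qed
  moreover have "\<forall>\<^sub>F k in sequentially. s k > 0"
    using e(2)
  proof eventually_elim
    case (elim k)
    have "(of_int (s k) :: rat) = c * (of_int e * r k)" by (simp add: s A_def mult_ac)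
    also have "\<dots> > 0" using elim c by simp
    finally show ?case by simp
  qed
  ultimately show ?thesis using A0 tt unfolding normalized_egf_def by blast
qed

text \<open>
Two normalized sequences for the same function are proportional, with a rational ratio \<open>p / q\<close>.
Coprimality of both sets of initial values forces \<open>p = q\<close> up to sign, and a common index
at which both sequences are positive fixes the sign.
\<close>

lemma normalized_egf_unique:
  assumes "normalized_egf f A s" "normalized_egf f A' s'"
  shows "A = A' \<and> s = s'"
proof -
  have A: "A \<noteq> 0" "A' \<noteq> 0" using assms by (auto simp: normalized_egf_def)
  have proportional: "of_int (s k) * A' = of_int (s' k) * A" for k
  proof -
    have "(\<lambda>k. of_int (s' k) / of_rat A' * (x ^ k / fact k)) sums f x" for x
      using assms(2) by (simp add: normalized_egf_def)
    from normalized_egf_coefficients[OF assms(1) this]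
    have "of_int (s k) / of_rat A = (of_int (s' k) / of_rat A' :: complex)" .
    hence "of_rat (of_int (s k) / A) = (of_rat (of_int (s' k) / A') :: complex)"
      by (simp add: of_rat_divide)
    hence "of_int (s k) / A = of_int (s' k) / A'" by (simp only: of_rat_eq_iff)
    thus ?thesis using A by (simp add: field_simps)
  qed
  obtain a b :: int where ab: "A = Fract a b" "b > 0" "a \<noteq> 0" using A(1)
    by (cases A) (auto simp: Zero_rat_def eq_rat)
  obtain a' b' where ab': "A' = Fract a' b'" "b' > 0" "a' \<noteq> 0" using A(2)
    by (cases A') (auto simp: Zero_rat_def eq_rat)
  define p where "p = a' * b"
  define q where "q = a * b'"
  have pq: "p * s k = q * s' k" for k
  proof -
    have "of_int (p * s k) = (of_int (q * s' k) :: rat)"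
      using proportional[of k] ab ab' by (simp add: p_def q_def Fract_of_int_quotient field_simps)
    thus ?thesis by (simp only: of_int_eq_iff)
  qed
  have "\<bar>p\<bar> = \<bar>q\<bar>"
  proof -
    have "Gcd ((*) p ` s ` {..<4}) = Gcd ((*) q ` s' ` {..<4})"
      by (simp add: image_image pq)
    thus ?thesis
      using assms unfolding Gcd_mult initial_values_image by (simp add: normalized_egf_def)
  qed
  have "\<forall>\<^sub>F k in sequentially. s k > 0 \<and> s' k > 0"
    using assms by (simp add: normalized_egf_def eventually_conj)
  then obtain k where k: "s k > 0" "s' k > 0"
    using eventually_happens'[OF sequentially_bot] by blast
  have "p = q"
  proof (rule ccontr)
    assume "p \<noteq> q"
    hence "p = - q" using \<open>\<bar>p\<bar> = \<bar>q\<bar>\<close> by linarith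
    hence "q * (s k + s' k) = 0" using pq[of k] by (simp add: algebra_simps)
    thus False using k ab ab' by (simp add: q_def)
  qed
  hence "s = s'" using pq ab ab' by (auto simp: q_def)
  moreover have "A = A'"
    using proportional[of k] \<open>s = s'\<close> k by simp
  ultimately show ?thesis by simp
qed

lemma sums_moments:
  assumes "finite R"
  shows "(\<lambda>k. moment R w k * (x ^ k / fact k)) sums (\<Sum>z\<in>R. w z * exp (z * x))"
proof -
  have "(\<lambda>k. \<Sum>z\<in>R. w z * ((z * x) ^ k / fact k)) sums (\<Sum>z\<in>R. w z * exp (z * x))"
    by (intro sums_sum sums_mult)
       (use exp_converges[of "z * x" for z] in \<open>simp add: scaleR_conv_of_real field_simps\<close>)
  thus ?thesis by (simp add: moment_def sum_divide_distrib sum_distrib_left power_mult_distrib mult_ac)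
qed

text \<open>
Existence and uniqueness together show that the definite description behind \<open>normalized_pair\<close>
denotes; hence the normalized sequence divided by its normalizer recovers the moments. All later
arguments use \<open>U\<close>, \<open>V\<close>, \<open>A1\<close> and \<open>A2\<close> only through these quotients.
\<close>

lemma normalized_pair_moment:
  assumes roots: "tetranacci_roots \<alpha> \<beta> \<gamma> \<delta>"
    and rat: "rational_moments {\<alpha>, \<beta>, \<gamma>, \<delta>} w"
    and nz: "\<And>z. z \<in> {\<alpha>, \<beta>, \<gamma>, \<delta>} \<Longrightarrow> w z \<noteq> 0"
    and f: "\<And>x. f x = (\<Sum>z\<in>{\<alpha>, \<beta>, \<gamma>, \<delta>}. w z * exp (z * x))"
  shows "of_int (snd (normalized_pair f) k) / of_rat (fst (normalized_pair f)) =
    moment {\<alpha>, \<beta>, \<gamma>, \<delta>} w k"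
proof -
  let ?R = "{\<alpha>, \<beta>, \<gamma>, \<delta>}"
  have sums: "(\<lambda>k. moment ?R w k * (x ^ k / fact k)) sums f x" for x
    unfolding f by (rule sums_moments) simp
  have "\<exists>r. \<forall>k. moment ?R w k = of_rat (r k)"
    using rat unfolding rational_moments_def by (intro choice) (auto elim: Rats_cases)
  then obtain r :: "nat \<Rightarrow> rat" where r: "\<And>k. moment ?R w k = of_rat (r k)" by blast
  obtain \<rho> :: real where \<rho>: "\<rho> > 1" "\<rho> ^ 4 = \<rho> ^ 3 + \<rho> ^ 2 + \<rho> + 1"
    "\<And>z :: complex. z ^ 4 = z ^ 3 + z ^ 2 + z + 1 \<Longrightarrow> z \<noteq> of_real \<rho> \<Longrightarrow> norm z < \<rho>"
    using tetranacci_dominant_root by blast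
  have "complex_of_real \<rho> ^ 4 = of_real \<rho> ^ 3 + of_real \<rho> ^ 2 + of_real \<rho> + 1"
    using arg_cong[OF \<rho>(2), of complex_of_real] by simp
  hence "complex_of_real \<rho> \<in> {z. z ^ 4 - z ^ 3 - z ^ 2 - z - 1 = 0}" by simp
  hence \<rho>_in: "of_real \<rho> \<in> ?R" using roots by (simp only: tetranacci_roots_def)
  have "of_rat (r (k + 4)) = (of_rat (r (k + 3) + r (k + 2) + r (k + 1) + r k) :: complex)" for k
    using moment_recurrence[OF tetranacci_roots_power4[OF roots], of ?R w k]
    by (simp only: r of_rat_add)
  hence rec: "r (k + 4) = r (k + 3) + r (k + 2) + r (k + 1) + r k" for k
    by (simp only: of_rat_eq_iff)
  have sign: "(\<forall>\<^sub>F k in sequentially. r k > 0) \<or> (\<forall>\<^sub>F k in sequentially. r k < 0)"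
    by (rule eventual_sign_of_moments[OF _ \<rho>_in _ _ r nz[OF \<rho>_in]])
       (use \<rho> tetranacci_roots_power4[OF roots] in auto)
  obtain A s where As: "normalized_egf f A s"
    using normalized_egf_exists[OF sums[unfolded r] rec sign] by blast
  have "normalized_pair f = (A, s)"
    unfolding normalized_pair_def
  proof (rule the_equality)
    show "normalized_egf f (fst (A, s)) (snd (A, s))" using As by simp
    show "p = (A, s)" if "normalized_egf f (fst p) (snd p)" for p
      using normalized_egf_unique[OF As that] by (simp add: prod_eq_iff)
  qed
  thus ?thesis using normalized_egf_coefficients[OF As sums] by simp
qed

lemma tetra_U_moment:
  assumes "tetranacci_roots \<alpha> \<beta> \<gamma> \<delta>"
  shows "tetra_U \<alpha> \<beta> \<gamma> \<delta> n k / tetra_A1 \<alpha> \<beta> \<gamma> \<delta> n =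
    moment {\<alpha>, \<beta>, \<gamma>, \<delta>} (\<lambda>z. tetranacci_coeff z ^ n) k"
  unfolding tetra_U_def tetra_A1_def
proof (rule normalized_pair_moment[OF assms rational_moments_coeff_power[OF assms]])
  show "tetranacci_coeff z ^ n \<noteq> 0" if "z \<in> {\<alpha>, \<beta>, \<gamma>, \<delta>}" for z
    using coeff_denom_nonzero[OF assms that] by (simp add: tetranacci_coeff_eq_inverse)
  show "egf1 \<alpha> \<beta> \<gamma> \<delta> n x = (\<Sum>z\<in>{\<alpha>, \<beta>, \<gamma>, \<delta>}. tetranacci_coeff z ^ n * exp (z * x))" for x
    by (simp add: egf1_def Let_def tetranacci_roots_sum[OF assms])
qed

lemma prod_tetranacci_coeff:
  assumes "tetranacci_roots \<alpha> \<beta> \<gamma> \<delta>"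
  shows "tetranacci_coeff \<alpha> * tetranacci_coeff \<beta> * tetranacci_coeff \<gamma> * tetranacci_coeff \<delta> = - 1 / 563"
proof -
  have "tetranacci_coeff \<alpha> * tetranacci_coeff \<beta> * tetranacci_coeff \<gamma> * tetranacci_coeff \<delta>
      = inverse (coeff_denom \<alpha> * coeff_denom \<beta> * coeff_denom \<gamma> * coeff_denom \<delta>)"
    by (simp add: tetranacci_coeff_eq_inverse)
  thus ?thesis unfolding prod_coeff_denom[OF assms] by simp
qed

text \<open>
Since the product of all four coefficients is \<open>- 1 / 563\<close>, a product of three of them is
\<open>- 1 / 563\<close> times the denominator of the fourth, which is a rational polynomial in the fourth root.
\<close>

lemma tetra_V_moment:
  assumes "tetranacci_roots \<alpha> \<beta> \<gamma> \<delta>"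
  defines "c \<equiv> tetranacci_coeff"
  shows "tetra_V \<alpha> \<beta> \<gamma> \<delta> n k / tetra_A2 \<alpha> \<beta> \<gamma> \<delta> n =
    (c \<beta> * c \<gamma> * c \<delta>) ^ n * \<alpha> ^ k + (c \<alpha> * c \<gamma> * c \<delta>) ^ n * \<beta> ^ k
    + (c \<alpha> * c \<beta> * c \<delta>) ^ n * \<gamma> ^ k + (c \<alpha> * c \<beta> * c \<gamma>) ^ n * \<delta> ^ k"
proof -
  let ?w = "\<lambda>z. (- coeff_denom z / 563) ^ n"
  have c: "c z * coeff_denom z = 1" if "z \<in> {\<alpha>, \<beta>, \<gamma>, \<delta>}" for z
    using coeff_denom_nonzero[OF assms(1) that] by (simp add: c_def tetranacci_coeff_eq_inverse)
  have prod: "c \<alpha> * c \<beta> * c \<gamma> * c \<delta> = - 1 / 563"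
    unfolding c_def by (rule prod_tetranacci_coeff[OF assms(1)])
  have cofactor: "- coeff_denom z / 563 = p"
    if "z \<in> {\<alpha>, \<beta>, \<gamma>, \<delta>}" "c z * p = - 1 / 563" for z p
  proof -
    have "- coeff_denom z / 563 = coeff_denom z * (c z * p)" using that(2) by simp
    also have "\<dots> = (c z * coeff_denom z) * p" by (simp only: mult_ac)
    finally show ?thesis using c[OF that(1)] by simp
  qed
  have w: "- coeff_denom \<alpha> / 563 = c \<beta> * c \<gamma> * c \<delta>" "- coeff_denom \<beta> / 563 = c \<alpha> * c \<gamma> * c \<delta>"
    "- coeff_denom \<gamma> / 563 = c \<alpha> * c \<beta> * c \<delta>" "- coeff_denom \<delta> / 563 = c \<alpha> * c \<beta> * c \<gamma>"
    by (rule cofactor; simp add: mult_ac prod[simplified mult_ac])+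
  have "tetra_V \<alpha> \<beta> \<gamma> \<delta> n k / tetra_A2 \<alpha> \<beta> \<gamma> \<delta> n = moment {\<alpha>, \<beta>, \<gamma>, \<delta>} ?w k"
    unfolding tetra_V_def tetra_A2_def
  proof (rule normalized_pair_moment[OF assms(1) rational_moments_denom_power[OF assms(1)]])
    show "?w z \<noteq> 0" if "z \<in> {\<alpha>, \<beta>, \<gamma>, \<delta>}" for z
      using coeff_denom_nonzero[OF assms(1) that] by simp
    show "egf2 \<alpha> \<beta> \<gamma> \<delta> n x = (\<Sum>z\<in>{\<alpha>, \<beta>, \<gamma>, \<delta>}. ?w z * exp (z * x))" for x
      unfolding tetranacci_roots_sum[OF assms(1)] w
      by (simp add: egf2_def Let_def c_def power_mult_distrib)
  qed
  thus ?thesis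
    unfolding moment_def tetranacci_roots_sum[OF assms(1)] w .
qed

section \<open>Exponential generating functions as formal power series\<close>

definition egf :: "(nat \<Rightarrow> complex) \<Rightarrow> complex fps" where
  "egf s = Abs_fps (\<lambda>k. s k / fact k)"

lemma egf_nth: "fact m * fps_nth (egf s) m = s m"
  by (simp add: egf_def)

lemma egf_mult_nth:
  "fact m * fps_nth (egf a * egf b) m = (\<Sum>k=0..m. of_nat (m choose k) * a k * b (m - k))"
  by (simp add: fps_mult_nth egf_def sum_distrib_left binomial_fact mult.assoc)

lemma sum_compositions3:
  "(\<Sum>(k1, k2, k3) \<in> {(k1, k2, k3). k1 + k2 + k3 = (m::nat)}. h k1 k2 k3)
    = (\<Sum>i=0..m. \<Sum>j=0..m - i. h i j (m - i - j) :: complex)"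
  unfolding sum.Sigma[OF finite_atLeastAtMost ballI[OF finite_atLeastAtMost]]
  by (rule sum.reindex_bij_witness[where i = "\<lambda>(i, j). (i, j, m - i - j)" and j = "\<lambda>(i, j, k). (i, j)"])
     auto

lemma sum_compositions4:
  "(\<Sum>(k1, k2, k3, k4) \<in> {(k1, k2, k3, k4). k1 + k2 + k3 + k4 = (m::nat)}. h k1 k2 k3 k4)
    = (\<Sum>i=0..m. \<Sum>(k2, k3, k4) \<in> {(k2, k3, k4). k2 + k3 + k4 = m - i}. h i k2 k3 k4 :: complex)"
proof -
  have fin: "finite {(a, b, c). a + b + c = (l::nat)}" for l
    by (rule finite_subset[of _ "{..l} \<times> {..l} \<times> {..l}"]) auto
  show ?thesis
    unfolding sum.Sigma[OF finite_atLeastAtMost ballI[OF fin]]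
    by (rule sum.reindex_bij_witness[where i = "\<lambda>(i, j). (i, j)" and j = "\<lambda>(i, j). (i, j)"]) auto
qed

lemma egf_mult3_nth:
  "fact m * fps_nth (egf a * egf b * egf c) m =
    (\<Sum>(k1, k2, k3) \<in> {(k1, k2, k3). k1 + k2 + k3 = m}. multinomial m [k1, k2, k3] * a k1 * b k2 * c k3)"
  unfolding sum_compositions3 mult.assoc
  by (simp add: fps_mult_nth egf_def sum_distrib_left sum_distrib_right multinomial_def mult_ac)

lemma egf_mult4_nth:
  "fact m * fps_nth (egf a * egf b * egf c * egf d) m =
    (\<Sum>(k1, k2, k3, k4) \<in> {(k1, k2, k3, k4). k1 + k2 + k3 + k4 = m}.
      multinomial m [k1, k2, k3, k4] * a k1 * b k2 * c k3 * d k4)"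
  unfolding sum_compositions4 sum_compositions3 mult.assoc
  by (simp add: fps_mult_nth egf_def sum_distrib_left sum_distrib_right multinomial_def mult_ac)

lemma egf_add: "egf (\<lambda>k. a k + b k) = egf a + egf b"
  by (simp add: egf_def fps_eq_iff add_divide_distrib)

lemma egf_geometric: "egf (\<lambda>k. a * z ^ k) = fps_const a * fps_exp z"
  by (simp add: egf_def fps_eq_iff)

section \<open>The quartic convolution identity\<close>

text \<open>
The products on the right span the symmetric quartics redundantly: there are nine products for
five monomial symmetric functions. The four free parameters record this redundancy, and the other
five coefficients result from comparing the monomials \<open>x^4\<close>, \<open>x^3 y\<close>, \<open>x^2 y^2\<close>,
\<open>x^2 y z\<close> and \<open>x y z w\<close>.
\<close>

lemma quartic_symmetric_identity:
  fixes x y z w d e g h :: "'a :: idom"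
  defines "p1 \<equiv> x + y + z + w" and "p2 \<equiv> x^2 + y^2 + z^2 + w^2"
    and "p3 \<equiv> x^3 + y^3 + z^3 + w^3" and "p4 \<equiv> x^4 + y^4 + z^4 + w^4"
    and "e2 \<equiv> x * y + x * z + x * w + y * z + y * w + z * w"
    and "e3 \<equiv> y * z * w + x * z * w + x * y * w + x * y * z"
    and "e4 \<equiv> x * y * z * w"
  shows "p1 * p1 * p1 * p1 =
    (- d + e + g + h - 3) * p4 + (- 4 * d + 4 * e + 4 * g + 4 * h - 12) * e4
    + (- e - 2 * g - h + 4) * (p3 * p1) + d * (p2 * p2) + e * (p2 * e2)
    + (- 2 * d - 2 * g - 2 * h + 6) * (e2 * e2) + g * (p2 * p1 * p1) + h * (e2 * p1 * p1)
    + (4 * d - e + 2 * g - h) * (e3 * p1)"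
  unfolding assms by algebra

text \<open>
Multiplication of generating functions turns each convolution sum into \<open>m!\<close> times a coefficient of
a product of symmetric polynomials in the four series \<open>x z\<close>, so comparing coefficients in the quartic
identity gives the formula.
\<close>

theorem theorem14:
  fixes \<alpha> \<beta> \<gamma> \<delta> A B C D E F G H J :: complex
    and A1 A2 :: "nat \<Rightarrow> complex"
    and U V t1 :: "nat \<Rightarrow> nat \<Rightarrow> complex"
    and m n :: nat
  assumes roots: "tetranacci_roots \<alpha> \<beta> \<gamma> \<delta>"
    and A1: "A1 = tetra_A1 \<alpha> \<beta> \<gamma> \<delta>"
    and A2: "A2 = tetra_A2 \<alpha> \<beta> \<gamma> \<delta>"
    and U: "U = tetra_U \<alpha> \<beta> \<gamma> \<delta>"
    and V: "V = tetra_V \<alpha> \<beta> \<gamma> \<delta>"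
    and t1: "t1 = tetra_t1 \<alpha> \<beta> \<gamma> \<delta>"
    and A: "A = - D + E + G + H - 3"
    and B: "B = - 4 * D + 4 * E + 4 * G + 4 * H - 12"
    and C: "C = - E - 2 * G - H + 4"
    and F: "F = - 2 * D - 2 * G - 2 * H + 6"
    and J: "J = 4 * D - E + 2 * G - H"
    and n: "n \<ge> 1"
  shows
    "1 / (A1 n) ^ 4 *
       (\<Sum>(k1, k2, k3, k4) \<in> {(k1, k2, k3, k4). k1 + k2 + k3 + k4 = m}.
          multinomial m [k1, k2, k3, k4] * U n k1 * U n k2 * U n k3 * U n k4)
     = A / A1 (4 * n) * 4 ^ m * U (4 * n) m
     + B * (- 1 / 563) ^ n
     + C / (A1 (3 * n) * A1 n) *
         (\<Sum>k=0..m. of_nat (m choose k) * 3 ^ (m - k) * U (3 * n) (m - k) * U n k)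
     + D / (A1 (2 * n)) ^ 2 *
         (\<Sum>k=0..m. of_nat (m choose k) * 2 ^ m * U (2 * n) k * U (2 * n) (m - k))
     + E / A1 (2 * n) *
         (\<Sum>k=0..m. of_nat (m choose k) * 2 ^ (m - k) * U (2 * n) (m - k) * t1 n k)
     + F * (\<Sum>k=0..m. of_nat (m choose k) * t1 n k * t1 n (m - k))
     + G / (A1 (2 * n) * (A1 n) ^ 2) *
         (\<Sum>(k1, k2, k3) \<in> {(k1, k2, k3). k1 + k2 + k3 = m}.
            multinomial m [k1, k2, k3] * 2 ^ k1 * U (2 * n) k1 * U n k2 * U n k3)
     + H / (A1 n) ^ 2 *
         (\<Sum>(k1, k2, k3) \<in> {(k1, k2, k3). k1 + k2 + k3 = m}.
            multinomial m [k1, k2, k3] * t1 n k1 * U n k2 * U n k3)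
     + J / (A2 n * A1 n) *
         (\<Sum>(k1, k2, k3) \<in> {(k1, k2, k3). k1 + k2 + k3 = m}.
            multinomial m [k1, k2, k3] * (- 1) ^ k1 * V n k1 * U n k2)"
proof -
  define u where "u j k = U j k / A1 j" for j k
  have u: "u j k = moment {\<alpha>, \<beta>, \<gamma>, \<delta>} (\<lambda>z. tetranacci_coeff z ^ j) k" for j k
    unfolding u_def U A1 by (rule tetra_U_moment[OF roots])
  define v where "v k = V n k / A2 n" for k
  \<comment> \<open>The formal versions of c ^ n * exp (z * t); P j, e2, e3 and e4 are their power sums and
     elementary symmetric functions.\<close>
  define x where "x z = fps_const (tetranacci_coeff z ^ n) * fps_exp z" for z
  define P where "P j = x \<alpha> ^ j + x \<beta> ^ j + x \<gamma> ^ j + x \<delta> ^ j" for j :: nat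
  define e2 where "e2 = x \<alpha> * x \<beta> + x \<alpha> * x \<gamma> + x \<alpha> * x \<delta> + x \<beta> * x \<gamma> + x \<beta> * x \<delta> + x \<gamma> * x \<delta>"
  define e3 where "e3 = x \<beta> * x \<gamma> * x \<delta> + x \<alpha> * x \<gamma> * x \<delta> + x \<alpha> * x \<beta> * x \<delta> + x \<alpha> * x \<beta> * x \<gamma>"
  define e4 where "e4 = x \<alpha> * x \<beta> * x \<gamma> * x \<delta>"
  have x_power: "x z ^ j = fps_const (tetranacci_coeff z ^ (j * n)) * fps_exp (of_nat j * z)" for z j
    by (simp add: x_def power_mult_distrib fps_const_power fps_exp_power_mult power_mult[symmetric] mult.commute)
  \<comment> \<open>The j-th power of c ^ n * exp (z * t) is c ^ (j n) * exp (j z t), whence the factors j ^ k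
     and the upper index j n.\<close>
  have egf_power_sum: "egf (\<lambda>k. of_nat j ^ k * u (j * n) k) = P j" for j
  proof -
    have "of_nat j ^ k * u (j * n) k =
        tetranacci_coeff \<alpha> ^ (j * n) * (of_nat j * \<alpha>) ^ k + tetranacci_coeff \<beta> ^ (j * n) * (of_nat j * \<beta>) ^ k
        + tetranacci_coeff \<gamma> ^ (j * n) * (of_nat j * \<gamma>) ^ k + tetranacci_coeff \<delta> ^ (j * n) * (of_nat j * \<delta>) ^ k" for k
      unfolding u moment_def tetranacci_roots_sum[OF roots] by (simp add: power_mult_distrib algebra_simps)
    thus ?thesis by (simp add: egf_add egf_geometric P_def x_power)
  qed
  have P1: "egf (u n) = P 1" using egf_power_sum[of 1] by simp
  have P2: "egf (\<lambda>k. 2 ^ k * u (2 * n) k) = P 2" using egf_power_sum[of 2] by simp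
  have P3: "egf (\<lambda>k. 3 ^ k * u (3 * n) k) = P 3" using egf_power_sum[of 3] by simp
  have P4: "egf (\<lambda>k. 4 ^ k * u (4 * n) k) = P 4" using egf_power_sum[of 4] by simp
  have E2: "egf (t1 n) = e2"
  proof (rule fps_ext)
    fix k
    have "t1 n k = 1 / 2 * ((\<Sum>i=0..k. of_nat (k choose i) * u n i * u n (k - i)) - 2 ^ k * u (2 * n) k)"
      unfolding t1 tetra_t1_def Let_def u_def A1 U
      by (simp add: sum_distrib_left power2_eq_square mult_ac)
    also have "\<dots> = fact k * fps_nth (fps_const (1 / 2) * (P 1 * P 1 - P 2)) k"
      unfolding egf_mult_nth[symmetric] P1 P2[symmetric] by (simp add: egf_def right_diff_distrib)
    also have "P 1 * P 1 - P 2 = fps_const 2 * e2"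
      unfolding P_def e2_def by (simp add: numeral_fps_const[symmetric] algebra_simps power2_eq_square)
    finally show "fps_nth (egf (t1 n)) k = fps_nth e2 k" by (simp add: egf_def)
  qed
  have V_eq: "v k = (tetranacci_coeff \<beta> * tetranacci_coeff \<gamma> * tetranacci_coeff \<delta>) ^ n * \<alpha> ^ k
      + (tetranacci_coeff \<alpha> * tetranacci_coeff \<gamma> * tetranacci_coeff \<delta>) ^ n * \<beta> ^ k
      + (tetranacci_coeff \<alpha> * tetranacci_coeff \<beta> * tetranacci_coeff \<delta>) ^ n * \<gamma> ^ k
      + (tetranacci_coeff \<alpha> * tetranacci_coeff \<beta> * tetranacci_coeff \<gamma>) ^ n * \<delta> ^ k" for k
    unfolding v_def V A2 by (rule tetra_V_moment[OF roots])
  \<comment> \<open>The sum of the roots accounts for the constant sequence in the V-term: exp((\<beta> + \<gamma> + \<delta>) t)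
     = exp(t) exp(- \<alpha> t), and the factor exp(t) carries the index k3 that has no sequence attached.\<close>
  have root_sum: "\<alpha> + \<beta> + \<gamma> + \<delta> = 1" by (rule tetranacci_vieta(1)[OF roots])
  have x3: "x a * x b * x c = fps_const ((tetranacci_coeff a * tetranacci_coeff b * tetranacci_coeff c) ^ n) *
      fps_exp (- d) * fps_exp 1" if "a + b + c + d = 1" for a b c d
  proof -
    have "fps_exp (- d) * fps_exp 1 = fps_exp a * fps_exp b * fps_exp c"
      using that by (simp flip: fps_exp_add_mult) (simp add: algebra_simps flip: that)
    thus ?thesis
      unfolding mult.assoc by (simp add: x_def power_mult_distrib mult_ac flip: fps_const_mult)
  qed
  have E3: "egf (\<lambda>k. (- 1) ^ k * v k) * egf (\<lambda>_. 1) = e3"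
  proof -
    have "(\<lambda>k. (- 1) ^ k * v k) = (\<lambda>k. (tetranacci_coeff \<beta> * tetranacci_coeff \<gamma> * tetranacci_coeff \<delta>) ^ n * (- \<alpha>) ^ k
      + (tetranacci_coeff \<alpha> * tetranacci_coeff \<gamma> * tetranacci_coeff \<delta>) ^ n * (- \<beta>) ^ k
      + (tetranacci_coeff \<alpha> * tetranacci_coeff \<beta> * tetranacci_coeff \<delta>) ^ n * (- \<gamma>) ^ k
      + (tetranacci_coeff \<alpha> * tetranacci_coeff \<beta> * tetranacci_coeff \<gamma>) ^ n * (- \<delta>) ^ k)"
      unfolding V_eq power_minus[of \<alpha>] power_minus[of \<beta>] power_minus[of \<gamma>] power_minus[of \<delta>]
      by (simp add: algebra_simps)
    moreover have "egf (\<lambda>_. 1) = fps_exp 1" using egf_geometric[of 1 1] by simp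
    moreover have "\<beta> + \<gamma> + \<delta> + \<alpha> = 1" "\<alpha> + \<gamma> + \<delta> + \<beta> = 1" "\<alpha> + \<beta> + \<delta> + \<gamma> = 1"
      using root_sum by (simp_all add: add_ac)
    ultimately show ?thesis
      using root_sum by (simp only: egf_add egf_geometric e3_def x3 distrib_right)
  qed
  have E4: "egf (\<lambda>_. (- 1 / 563) ^ n) = e4"
  proof -
    have "e4 = fps_const ((tetranacci_coeff \<alpha> * tetranacci_coeff \<beta> * tetranacci_coeff \<gamma> * tetranacci_coeff \<delta>) ^ n)
        * fps_exp (\<alpha> + \<beta> + \<gamma> + \<delta>)"
      by (simp add: e4_def x_def fps_exp_add_mult power_mult_distrib mult_ac flip: fps_const_mult)
    thus ?thesis
      unfolding prod_tetranacci_coeff[OF roots] root_sum using egf_geometric[of _ 1] by simp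
  qed
  have identity: "P 1 * P 1 * P 1 * P 1 =
      fps_const A * P 4 + fps_const B * e4 + fps_const C * (P 3 * P 1) + fps_const D * (P 2 * P 2)
      + fps_const E * (P 2 * e2) + fps_const F * (e2 * e2) + fps_const G * (P 2 * P 1 * P 1)
      + fps_const H * (e2 * P 1 * P 1) + fps_const J * (e3 * P 1)"
  proof -
    define d where "d = fps_const D"
    define e where "e = fps_const E"
    define g where "g = fps_const G"
    define h where "h = fps_const H"
    note defs = d_def e_def g_def h_def
    have "fps_const A = - d + e + g + h - 3" "fps_const B = - 4 * d + 4 * e + 4 * g + 4 * h - 12"
      "fps_const C = - e - 2 * g - h + 4" "fps_const F = - 2 * d - 2 * g - 2 * h + 6"
      "fps_const J = 4 * d - e + 2 * g - h"
      unfolding A B C F J defs by (simp_all add: numeral_fps_const)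
    thus ?thesis
      unfolding P_def e2_def e3_def e4_def defs[symmetric] power_one_right
      by (simp only: quartic_symmetric_identity)
  qed
  have term_A: "fact m * fps_nth (P 4) m = 4 ^ m * u (4 * n) m"
    unfolding P4[symmetric] by (rule egf_nth)
  have term_B: "fact m * fps_nth e4 m = (- 1 / 563) ^ n"
    unfolding E4[symmetric] by (rule egf_nth)
  have term_C: "fact m * fps_nth (P 3 * P 1) m =
      (\<Sum>k=0..m. of_nat (m choose k) * 3 ^ (m - k) * u (3 * n) (m - k) * u n k)"
    unfolding P3[symmetric] P1[symmetric] mult.commute[of "egf (\<lambda>k. 3 ^ k * u (3 * n) k)"]
    unfolding egf_mult_nth by (simp add: mult_ac)
  have term_D: "fact m * fps_nth (P 2 * P 2) m =
      (\<Sum>k=0..m. of_nat (m choose k) * 2 ^ m * u (2 * n) k * u (2 * n) (m - k))"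
    unfolding P2[symmetric] egf_mult_nth
  proof (rule sum.cong[OF refl])
    fix k assume "k \<in> {0..m}"
    hence "(2 :: complex) ^ m = 2 ^ k * 2 ^ (m - k)" by (simp flip: power_add)
    thus "of_nat (m choose k) * (2 ^ k * u (2 * n) k) * (2 ^ (m - k) * u (2 * n) (m - k))
      = of_nat (m choose k) * 2 ^ m * u (2 * n) k * u (2 * n) (m - k)" by simp
  qed
  have term_E: "fact m * fps_nth (P 2 * e2) m =
      (\<Sum>k=0..m. of_nat (m choose k) * 2 ^ (m - k) * u (2 * n) (m - k) * t1 n k)"
    unfolding P2[symmetric] E2[symmetric] mult.commute[of "egf (\<lambda>k. 2 ^ k * u (2 * n) k)"]
    unfolding egf_mult_nth by (simp add: mult_ac)
  have term_F: "fact m * fps_nth (e2 * e2) m = (\<Sum>k=0..m. of_nat (m choose k) * t1 n k * t1 n (m - k))"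
    unfolding E2[symmetric] by (rule egf_mult_nth)
  have term_G: "fact m * fps_nth (P 2 * P 1 * P 1) m =
      (\<Sum>(k1, k2, k3) \<in> {(k1, k2, k3). k1 + k2 + k3 = m}.
        multinomial m [k1, k2, k3] * 2 ^ k1 * u (2 * n) k1 * u n k2 * u n k3)"
    unfolding P1[symmetric] P2[symmetric] egf_mult3_nth by (simp add: mult.assoc)
  have term_H: "fact m * fps_nth (e2 * P 1 * P 1) m =
      (\<Sum>(k1, k2, k3) \<in> {(k1, k2, k3). k1 + k2 + k3 = m}.
        multinomial m [k1, k2, k3] * t1 n k1 * u n k2 * u n k3)"
    unfolding P1[symmetric] E2[symmetric] by (rule egf_mult3_nth)
  have term_J: "fact m * fps_nth (e3 * P 1) m =
      (\<Sum>(k1, k2, k3) \<in> {(k1, k2, k3). k1 + k2 + k3 = m}.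
        multinomial m [k1, k2, k3] * (- 1) ^ k1 * v k1 * u n k2)"
  proof -
    have "e3 * P 1 = egf (\<lambda>k. (- 1) ^ k * v k) * egf (u n) * egf (\<lambda>_. 1)"
      unfolding P1[symmetric] E3[symmetric] by (simp only: mult_ac)
    thus ?thesis by (simp only: egf_mult3_nth) (simp add: mult.assoc)
  qed
  have lhs: "fact m * fps_nth (P 1 * P 1 * P 1 * P 1) m =
      (\<Sum>(k1, k2, k3, k4) \<in> {(k1, k2, k3, k4). k1 + k2 + k3 + k4 = m}.
        multinomial m [k1, k2, k3, k4] * u n k1 * u n k2 * u n k3 * u n k4)"
    unfolding P1[symmetric] by (rule egf_mult4_nth)
  note scaled_coefficients = arg_cong[OF identity, of "\<lambda>f. fact m * fps_nth f m"]
  show ?thesis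
    using scaled_coefficients
    unfolding fps_add_nth fps_mult_left_const_nth distrib_left mult.left_commute[of "fact m"]
      lhs term_A term_B term_C term_D term_E term_F term_G term_H term_J u_def v_def
    by (simp add: sum_distrib_left case_prod_unfold power2_eq_square power4_eq_xxxx mult_ac)
qed

end
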